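(* Let $R$ be a commutative ring and let $\mathfrak{a}\subseteq R$ be an ideal. If $\mathfrak{a}$ is principal and idempotent (i.e. $\mathfrak{a}^2=\mathfrak{a}$), then the $R$-module $R$ is $\mathfrak{a}$-fair.
   Context: Rings are commutative with unit (not assumed noetherian). $\mathrm{Var}(\mathfrak{a})$ is the set of prime ideals of $R$ containing $\mathfrak{a}$, and for an $R$-module $M$, $\Gamma_{\mathfrak{a}}(M)=\{x\in M\mid\exists n\in\mathbb{N}:\mathfrak{a}^nx=0\}$. The assassin $\mathrm{Ass}_R(M)$ is the set of prime ideals of $R$ of the form $(0:_Rx)=\{r\in R\mid rx=0\}$ for some $x\in M$. An $R$-module $M$ is called $\mathfrak{a}$-fair if $\mathrm{Ass}_R(M/\Gamma_{\mathfrak{a}}(M))=\mathrm{Ass}_R(M)\setminus\mathrm{Var}(\mathfrak{a})$. *)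

theory Defs
  imports "HOL-Algebra.Module" "HOL-Algebra.QuotRing" "HOL-Algebra.Ideal_Product"
begin

text \<open>
  The record type of \<^locale>\<open>module\<close> extends the one of rings, so a module record also carries the
  fields \<open>mult\<close> and \<open>one\<close>; the module axioms and the notions below do not refer to them.
\<close>

definition regular_module :: "('a, 'c) ring_scheme \<Rightarrow> ('a, 'a) module" where
  "regular_module R =
     \<lparr>carrier = carrier R, mult = mult R, one = \<one>\<^bsub>R\<^esub>, zero = \<zero>\<^bsub>R\<^esub>, add = add R,
      smult = mult R\<rparr>"

text \<open>
  The fields of the quotient module inherited from rings are those of \<^const>\<open>FactRing\<close>. For a
  submodule \<open>N\<close> the union defining \<open>smult\<close> is a union of equal cosets, so that
  \<open>r \<odot> (N +> x) = N +> (r \<odot> x)\<close>; see \<open>quotient_module_smult\<close>.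
\<close>

definition quotient_module ::
  "('a, 'b, 'd) module_scheme \<Rightarrow> 'b set \<Rightarrow> ('a, 'b set) module" where
  "quotient_module M N =
     \<lparr>carrier = a_rcosets\<^bsub>M\<^esub> N, mult = rcoset_mult M N, one = N +>\<^bsub>M\<^esub> \<one>\<^bsub>M\<^esub>, zero = N,
      add = set_add M, smult = (\<lambda>r X. \<Union>x\<in>X. N +>\<^bsub>M\<^esub> (r \<odot>\<^bsub>M\<^esub> x))\<rparr>"

definition ideal_power :: "('a, 'c) ring_scheme \<Rightarrow> 'a set \<Rightarrow> nat \<Rightarrow> 'a set" where
  "ideal_power R \<aa> n = \<aa> [^]\<^bsub>ideals_set R\<^esub> n"

definition Var :: "('a, 'c) ring_scheme \<Rightarrow> 'a set \<Rightarrow> 'a set set" where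
  "Var R \<aa> = {\<pp>. primeideal \<pp> R \<and> \<aa> \<subseteq> \<pp>}"

definition torsion :: "('a, 'c) ring_scheme \<Rightarrow> 'a set \<Rightarrow> ('a, 'b, 'd) module_scheme \<Rightarrow> 'b set" where
  "torsion R \<aa> M =
     {x \<in> carrier M. \<exists>n. \<forall>r \<in> ideal_power R \<aa> n. r \<odot>\<^bsub>M\<^esub> x = \<zero>\<^bsub>M\<^esub>}"

definition annihilator :: "('a, 'c) ring_scheme \<Rightarrow> ('a, 'b, 'd) module_scheme \<Rightarrow> 'b \<Rightarrow> 'a set" where
  "annihilator R M x = {r \<in> carrier R. r \<odot>\<^bsub>M\<^esub> x = \<zero>\<^bsub>M\<^esub>}"

definition Ass :: "('a, 'c) ring_scheme \<Rightarrow> ('a, 'b, 'd) module_scheme \<Rightarrow> 'a set set" where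
  "Ass R M = {\<pp>. primeideal \<pp> R \<and> (\<exists>x \<in> carrier M. \<pp> = annihilator R M x)}"

definition fair :: "('a, 'c) ring_scheme \<Rightarrow> 'a set \<Rightarrow> ('a, 'b, 'd) module_scheme \<Rightarrow> bool" where
  "fair R \<aa> M \<longleftrightarrow> Ass R (quotient_module M (torsion R \<aa> M)) = Ass R M - Var R \<aa>"

lemma ideal_power_0: "ideal_power R \<aa> 0 = carrier R"
  by (simp add: ideal_power_def ideals_set_def nat_pow_def)

lemma ideal_power_Suc: "ideal_power R \<aa> (Suc n) = ideal_power R \<aa> n \<cdot>\<^bsub>R\<^esub> \<aa>"
  by (simp add: ideal_power_def ideals_set_def nat_pow_def)

lemma ideal_power_ideal:
  assumes "ring R" "ideal \<aa> R"
  shows "ideal (ideal_power R \<aa> n) R"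
proof (induction n)
  case 0
  then show ?case using ring.oneideal[OF assms(1)] by (simp add: ideal_power_0)
next
  case (Suc n)
  then show ?case using ring.ideal_prod_is_ideal[OF assms(1)] assms(2)
    by (simp add: ideal_power_Suc)
qed

lemma ideal_power_antimono:
  assumes "ring R" "ideal \<aa> R" "m \<le> n"
  shows "ideal_power R \<aa> n \<subseteq> ideal_power R \<aa> m"
  using assms(3)
proof (induction rule: dec_induct)
  case (step n)
  then show ?case
    using ring.ideal_prod_inter[OF assms(1) ideal_power_ideal[OF assms(1,2)] assms(2)]
    by (simp add: ideal_power_Suc) blast
qed simp

lemma regular_module_is_module:
  assumes "cring R"
  shows "module R (regular_module R)"
proof -
  interpret cring R by fact
  have "abelian_group (regular_module R)"
  proof (rule abelian_groupI)
    show "\<exists>y\<in>carrier (regular_module R). y \<oplus>\<^bsub>regular_module R\<^esub> x = \<zero>\<^bsub>regular_module R\<^esub>"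
      if "x \<in> carrier (regular_module R)" for x
      using that by (intro bexI[of _ "\<ominus>\<^bsub>R\<^esub> x"]) (auto simp: regular_module_def l_neg)
  qed (simp_all add: regular_module_def a_ac)
  then show ?thesis
    by (intro moduleI cring_axioms)
      (simp_all add: regular_module_def l_distr r_distr m_assoc)
qed

lemma (in module) torsion_submodule:
  assumes "ideal \<aa> R"
  shows "submodule (torsion R \<aa> M) R M"
proof (rule submoduleI)
  have id: "ideal (ideal_power R \<aa> n) R" for n
    using ideal_power_ideal assms R.ring_axioms by blast
  have carr: "r \<in> carrier R" if "r \<in> ideal_power R \<aa> n" for r n
    using ideal.Icarr[OF id that] .
  show "torsion R \<aa> M \<subseteq> carrier M" by (auto simp: torsion_def)
  show "\<zero>\<^bsub>M\<^esub> \<in> torsion R \<aa> M" by (auto simp: torsion_def carr)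
  show "\<ominus>\<^bsub>M\<^esub> x \<in> torsion R \<aa> M" if "x \<in> torsion R \<aa> M" for x
  proof -
    from that obtain n where x: "x \<in> carrier M"
      and n: "\<And>s. s \<in> ideal_power R \<aa> n \<Longrightarrow> s \<odot>\<^bsub>M\<^esub> x = \<zero>\<^bsub>M\<^esub>"
      unfolding torsion_def by blast
    have "s \<odot>\<^bsub>M\<^esub> (\<ominus>\<^bsub>M\<^esub> x) = \<zero>\<^bsub>M\<^esub>" if s: "s \<in> ideal_power R \<aa> n" for s
      using n[OF s] smult_r_minus[OF carr[OF s] x] by simp
    then show ?thesis using x unfolding torsion_def by blast
  qed
  show "r \<odot>\<^bsub>M\<^esub> x \<in> torsion R \<aa> M" if r: "r \<in> carrier R" and "x \<in> torsion R \<aa> M" for r x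
  proof -
    from that obtain n where x: "x \<in> carrier M"
      and n: "\<And>s. s \<in> ideal_power R \<aa> n \<Longrightarrow> s \<odot>\<^bsub>M\<^esub> x = \<zero>\<^bsub>M\<^esub>"
      unfolding torsion_def by blast
    have "s \<odot>\<^bsub>M\<^esub> (r \<odot>\<^bsub>M\<^esub> x) = \<zero>\<^bsub>M\<^esub>" if s: "s \<in> ideal_power R \<aa> n" for s
      using n[OF ideal.I_r_closed[OF id s r]] smult_assoc1[OF carr[OF s] r x] by simp
    then show ?thesis using r x unfolding torsion_def by blast
  qed
  show "x \<oplus>\<^bsub>M\<^esub> y \<in> torsion R \<aa> M" if "x \<in> torsion R \<aa> M" "y \<in> torsion R \<aa> M" for x y
  proof -
    from that obtain m n where xy: "x \<in> carrier M" "y \<in> carrier M"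
      and m: "\<And>s. s \<in> ideal_power R \<aa> m \<Longrightarrow> s \<odot>\<^bsub>M\<^esub> x = \<zero>\<^bsub>M\<^esub>"
      and n: "\<And>s. s \<in> ideal_power R \<aa> n \<Longrightarrow> s \<odot>\<^bsub>M\<^esub> y = \<zero>\<^bsub>M\<^esub>"
      unfolding torsion_def by blast
    have "s \<odot>\<^bsub>M\<^esub> (x \<oplus>\<^bsub>M\<^esub> y) = \<zero>\<^bsub>M\<^esub>" if s: "s \<in> ideal_power R \<aa> (max m n)" for s
    proof -
      have "s \<in> ideal_power R \<aa> m" "s \<in> ideal_power R \<aa> n"
        using s ideal_power_antimono[OF R.ring_axioms assms] by (meson max.cobounded1 max.cobounded2 subsetD)+
      then show ?thesis using m n xy carr[OF s] by (simp add: smult_r_distr)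
    qed
    then show ?thesis using xy unfolding torsion_def by blast
  qed
qed

context module
begin

lemma submodule_abelian_subgroup:
  assumes "submodule N R M"
  shows "abelian_subgroup N M"
  using assms by (intro abelian_subgroupI3 M.abelian_group_axioms)
    (simp add: additive_subgroup_def submodule_def)

lemma quotient_module_smult:
  assumes N: "submodule N R M" and r: "r \<in> carrier R" and x: "x \<in> carrier M"
  shows "r \<odot>\<^bsub>quotient_module M N\<^esub> (N +>\<^bsub>M\<^esub> x) = N +>\<^bsub>M\<^esub> (r \<odot>\<^bsub>M\<^esub> x)"
proof -
  interpret N: abelian_subgroup N M using submodule_abelian_subgroup[OF N] .
  have eq: "N +>\<^bsub>M\<^esub> (r \<odot>\<^bsub>M\<^esub> y) = N +>\<^bsub>M\<^esub> (r \<odot>\<^bsub>M\<^esub> x)" if "y \<in> N +>\<^bsub>M\<^esub> x" for y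
  proof -
    from that obtain h where h: "h \<in> N" "y = h \<oplus>\<^bsub>M\<^esub> x"
      unfolding a_r_coset_def' by blast
    have "r \<odot>\<^bsub>M\<^esub> y = r \<odot>\<^bsub>M\<^esub> h \<oplus>\<^bsub>M\<^esub> r \<odot>\<^bsub>M\<^esub> x"
      using h r x by (simp add: smult_r_distr)
    then have "r \<odot>\<^bsub>M\<^esub> y \<in> N +>\<^bsub>M\<^esub> (r \<odot>\<^bsub>M\<^esub> x)"
      using submodule.smult_closed[OF N r h(1)] unfolding a_r_coset_def' by blast
    then show ?thesis using N.a_repr_independence' r x by auto
  qed
  have "N +>\<^bsub>M\<^esub> x \<noteq> {}" using N.a_rcos_self[OF x] by blast
  then have "(\<Union>y\<in>N +>\<^bsub>M\<^esub> x. N +>\<^bsub>M\<^esub> (r \<odot>\<^bsub>M\<^esub> y)) = N +>\<^bsub>M\<^esub> (r \<odot>\<^bsub>M\<^esub> x)"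
    using eq by (metis (no_types, lifting) SUP_eq_const)
  then show ?thesis by (simp add: quotient_module_def)
qed

lemma quotient_module_is_module:
  assumes N: "submodule N R M"
  shows "module R (quotient_module M N)"
proof -
  interpret N: abelian_subgroup N M using submodule_abelian_subgroup[OF N] .
  let ?Q = "quotient_module M N"
  have carr: "carrier ?Q = (\<lambda>x. N +>\<^bsub>M\<^esub> x) ` carrier M"
    by (auto simp: quotient_module_def A_RCOSETS_def')
  have add: "(N +>\<^bsub>M\<^esub> x) \<oplus>\<^bsub>?Q\<^esub> (N +>\<^bsub>M\<^esub> y) = N +>\<^bsub>M\<^esub> (x \<oplus>\<^bsub>M\<^esub> y)"
    if "x \<in> carrier M" "y \<in> carrier M" for x y
    using that by (simp add: quotient_module_def N.a_rcos_sum)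
  have "N +>\<^bsub>M\<^esub> \<zero>\<^bsub>M\<^esub> = N" using M.a_coset_add_zero N.a_subset by blast
  then have zero: "\<zero>\<^bsub>?Q\<^esub> = N +>\<^bsub>M\<^esub> \<zero>\<^bsub>M\<^esub>" by (simp add: quotient_module_def)
  note sm = quotient_module_smult[OF N]
  have "abelian_group ?Q"
  proof (rule abelian_groupI)
    show "\<exists>Y\<in>carrier ?Q. Y \<oplus>\<^bsub>?Q\<^esub> X = \<zero>\<^bsub>?Q\<^esub>" if X: "X \<in> carrier ?Q" for X
    proof -
      from X obtain x where x: "x \<in> carrier M" "X = N +>\<^bsub>M\<^esub> x" using carr by blast
      show ?thesis
        by (rule bexI[of _ "N +>\<^bsub>M\<^esub> (\<ominus>\<^bsub>M\<^esub> x)"]) (use x in \<open>auto simp: carr add zero M.l_neg\<close>)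
    qed
  qed (auto simp: carr add zero M.a_ac)
  then show ?thesis
    by (intro moduleI R.is_cring)
      (auto simp: carr add sm smult_l_distr smult_r_distr smult_assoc1)
qed

end

end

theory Submission
  imports Defs
begin

text \<open>
  A principal idempotent ideal \<open>\<aa>\<close> is generated by an idempotent element: if \<open>a\<close> generates
  \<open>\<aa> = \<aa> \<cdot> \<aa>\<close>, then \<open>a = s a\<^sup>2\<close> for some \<open>s\<close>, and \<open>e = s a\<close> satisfies \<open>e\<^sup>2 = e\<close> and
  \<open>e a = a\<close> (\<open>principal_idempotent_ideal_generator\<close>).

  Over such an ideal every module \<open>M\<close> is fair. All positive powers of \<open>\<aa>\<close> equal \<open>\<aa>\<close>, so the
  torsion submodule \<open>\<Gamma>\<close> is the kernel of multiplication by \<open>e\<close>, and \<open>M / \<Gamma>\<close> is isomorphic to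
  \<open>e M\<close>. In terms of annihilators, the coset of \<open>x\<close> has the annihilator of \<open>e x\<close>
  (\<open>annihilator_quotient_idempotent_torsion\<close>). Such an annihilator, if it is a proper ideal,
  does not contain \<open>e\<close>, since \<open>e e x = 0\<close> would give \<open>e x = 0\<close>; hence it does not contain \<open>\<aa>\<close>.
  Conversely, if the annihilator of \<open>x\<close> is a prime that does not contain \<open>\<aa>\<close>, hence not \<open>e\<close>,
  then passing from \<open>x\<close> to \<open>e x\<close> does not change it (\<open>prime_annihilator_smult\<close>).
\<close>

text \<open>
  The inclusion \<open>a R \<cdot> a R \<subseteq> a\<^sup>2 R\<close> lets \<open>a\<close> be written as a multiple of \<open>a\<^sup>2\<close>; the cofactor of
  one \<open>a\<close> is then an idempotent acting as the identity on \<open>a\<close>.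
\<close>

lemma (in cring) principal_idempotent_ideal_generator:
  assumes prin: "principalideal \<aa> R" and idem: "\<aa> \<cdot> \<aa> = \<aa>"
  obtains e where "e \<in> carrier R" "e \<otimes> e = e" "\<aa> = PIdl e"
proof -
  obtain a where a: "a \<in> carrier R" and \<aa>: "\<aa> = PIdl a"
    using principalideal.generate[OF prin] cgenideal_eq_genideal by blast
  have "\<aa> \<cdot> \<aa> = Idl (PIdl (a \<otimes> a))"
    using ideal_prod_eq_genideal[of \<aa> \<aa>] cgenideal_prod[OF a a] cgenideal_ideal[OF a] \<aa> by simp
  also have "\<dots> \<subseteq> PIdl (a \<otimes> a)"
    using genideal_minimal[OF cgenideal_ideal order_refl] a by blast
  finally have sub: "\<aa> \<cdot> \<aa> \<subseteq> PIdl (a \<otimes> a)" .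
  have "a \<in> \<aa> \<cdot> \<aa>" using cgenideal_self[OF a] \<aa> idem by simp
  then obtain s where s: "s \<in> carrier R" and as: "a = s \<otimes> (a \<otimes> a)"
    using sub unfolding cgenideal_def by blast
  define e where "e = s \<otimes> a"
  have e: "e \<in> carrier R" using a s by (simp add: e_def)
  have ea: "e \<otimes> a = a" using a s as[symmetric] by (simp add: e_def m_assoc)
  have "e \<otimes> e = s \<otimes> (e \<otimes> a)" using a s by (simp add: e_def m_ac)
  also have "\<dots> = e" by (simp only: ea) (simp only: e_def)
  finally have ee: "e \<otimes> e = e" .
  have "PIdl e = PIdl a"
  proof
    have "e \<in> PIdl a" using s by (auto simp: cgenideal_def e_def)
    then show "PIdl e \<subseteq> PIdl a" by (rule cgenideal_minimal[OF cgenideal_ideal[OF a]])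
    have "a \<otimes> e \<in> PIdl e" using a by (auto simp: cgenideal_def)
    moreover have "a \<otimes> e = a" using m_comm[OF a e] ea by (rule trans)
    ultimately have "a \<in> PIdl e" by (simp only:)
    then show "PIdl a \<subseteq> PIdl e" by (rule cgenideal_minimal[OF cgenideal_ideal[OF e]])
  qed
  then have "\<aa> = PIdl e" using \<aa> by (simp only:)
  with e ee show ?thesis by (rule that)
qed

lemma ideal_power_idempotent:
  assumes "cring R" "ideal \<aa> R" "\<aa> \<cdot>\<^bsub>R\<^esub> \<aa> = \<aa>"
  shows "ideal_power R \<aa> (Suc n) = \<aa>"
proof (induction n)
  case 0
  interpret cring R by fact
  have "carrier R \<cdot>\<^bsub>R\<^esub> \<aa> = \<aa>" using ideal_prod_one[OF assms(2)] ideal_prod_commute[OF oneideal assms(2)] by simp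
  then show ?case by (simp add: ideal_power_Suc ideal_power_0)
next
  case (Suc n)
  then show ?case using assms(3) by (simp add: ideal_power_Suc)
qed

context module
begin

text \<open>
  An element killed by the zeroth power of \<open>\<aa>\<close>, which is the whole ring, is killed by every
  power, so only positive powers matter, and these are all generated by \<open>e\<close>.
\<close>

lemma torsion_idempotent:
  assumes id: "ideal \<aa> R" and idem: "\<aa> \<cdot>\<^bsub>R\<^esub> \<aa> = \<aa>"
    and e: "e \<in> carrier R" and gen: "\<aa> = PIdl\<^bsub>R\<^esub> e"
  shows "torsion R \<aa> M = {x \<in> carrier M. e \<odot>\<^bsub>M\<^esub> x = \<zero>\<^bsub>M\<^esub>}"
proof (intro equalityI subsetI)
  fix x assume "x \<in> torsion R \<aa> M"
  then obtain n where x: "x \<in> carrier M"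
    and n: "\<And>r. r \<in> ideal_power R \<aa> n \<Longrightarrow> r \<odot>\<^bsub>M\<^esub> x = \<zero>\<^bsub>M\<^esub>"
    unfolding torsion_def by blast
  \<comment> \<open>Passing to \<open>Suc n\<close> avoids treating \<open>n = 0\<close>, where the power is the whole ring.\<close>
  have "e \<in> ideal_power R \<aa> (Suc n)"
    using ideal_power_idempotent[OF R.is_cring id idem] R.cgenideal_self[OF e] gen by simp
  then have "e \<in> ideal_power R \<aa> n"
    using ideal_power_antimono[OF R.ring_axioms id, of n "Suc n"] by auto
  with n x show "x \<in> {x \<in> carrier M. e \<odot>\<^bsub>M\<^esub> x = \<zero>\<^bsub>M\<^esub>}" by simp
next
  fix x assume "x \<in> {x \<in> carrier M. e \<odot>\<^bsub>M\<^esub> x = \<zero>\<^bsub>M\<^esub>}"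
  then have x: "x \<in> carrier M" "e \<odot>\<^bsub>M\<^esub> x = \<zero>\<^bsub>M\<^esub>" by auto
  have "r \<odot>\<^bsub>M\<^esub> x = \<zero>\<^bsub>M\<^esub>" if "r \<in> ideal_power R \<aa> (Suc 0)" for r
  proof -
    from that obtain s where "s \<in> carrier R" "r = s \<otimes>\<^bsub>R\<^esub> e"
      using ideal_power_idempotent[OF R.is_cring id idem] gen unfolding cgenideal_def by blast
    then show ?thesis using x e by (simp add: smult_assoc1)
  qed
  then show "x \<in> torsion R \<aa> M" using x(1) unfolding torsion_def by blast
qed

lemma annihilator_quotient:
  assumes N: "submodule N R M" and x: "x \<in> carrier M"
  shows "annihilator R (quotient_module M N) (N +>\<^bsub>M\<^esub> x) = {r \<in> carrier R. r \<odot>\<^bsub>M\<^esub> x \<in> N}"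
proof -
  interpret N: abelian_subgroup N M using submodule_abelian_subgroup[OF N] .
  have "N +>\<^bsub>M\<^esub> y = N \<longleftrightarrow> y \<in> N" if "y \<in> carrier M" for y
    using N.a_rcos_self[OF that] N.a_rcos_const by auto
  then have "r \<odot>\<^bsub>quotient_module M N\<^esub> (N +>\<^bsub>M\<^esub> x) = N \<longleftrightarrow> r \<odot>\<^bsub>M\<^esub> x \<in> N"
    if "r \<in> carrier R" for r
    using that x by (simp only: quotient_module_smult[OF N] smult_closed)
  moreover have "\<zero>\<^bsub>quotient_module M N\<^esub> = N" by (simp add: quotient_module_def)
  ultimately show ?thesis by (auto simp only: annihilator_def)
qed

text \<open>
  This is the embedding of \<open>M / \<Gamma>\<close> into \<open>M\<close> by multiplication with \<open>e\<close>, seen on annihilators: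
  \<open>r x\<close> is torsion exactly if \<open>e r x = 0\<close>. It turns the associated primes of the quotient into
  annihilators of elements of \<open>M\<close>.
\<close>

lemma annihilator_quotient_idempotent_torsion:
  assumes id: "ideal \<aa> R" and idem: "\<aa> \<cdot>\<^bsub>R\<^esub> \<aa> = \<aa>"
    and e: "e \<in> carrier R" and gen: "\<aa> = PIdl\<^bsub>R\<^esub> e" and x: "x \<in> carrier M"
  shows "annihilator R (quotient_module M (torsion R \<aa> M)) (torsion R \<aa> M +>\<^bsub>M\<^esub> x)
    = annihilator R M (e \<odot>\<^bsub>M\<^esub> x)"
proof -
  have "e \<odot>\<^bsub>M\<^esub> (r \<odot>\<^bsub>M\<^esub> x) = r \<odot>\<^bsub>M\<^esub> (e \<odot>\<^bsub>M\<^esub> x)" if "r \<in> carrier R" for r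
    using that e x by (simp add: smult_assoc1[symmetric] R.m_comm)
  then show ?thesis
    unfolding annihilator_quotient[OF torsion_submodule[OF id] x]
    using x by (auto simp: torsion_idempotent[OF id idem e gen] annihilator_def)
qed

text \<open>
  The submodule generated by \<open>x\<close> is isomorphic to \<open>R / \<pp>\<close>. This ring is a domain, so all its
  nonzero elements have annihilator \<open>\<pp>\<close>.
\<close>

lemma prime_annihilator_smult:
  assumes p: "primeideal \<pp> R" and ann: "\<pp> = annihilator R M x"
    and x: "x \<in> carrier M" and e: "e \<in> carrier R" "e \<notin> \<pp>"
  shows "annihilator R M (e \<odot>\<^bsub>M\<^esub> x) = \<pp>"
proof -
  note p_ideal = primeideal.axioms(1)[OF p]
  have "r \<in> annihilator R M (e \<odot>\<^bsub>M\<^esub> x) \<longleftrightarrow> r \<otimes>\<^bsub>R\<^esub> e \<in> \<pp>" if "r \<in> carrier R" for r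
    using that e(1) x by (simp add: ann annihilator_def smult_assoc1)
  moreover have "r \<otimes>\<^bsub>R\<^esub> e \<in> \<pp> \<longleftrightarrow> r \<in> \<pp>" if "r \<in> carrier R" for r
    using primeideal.I_prime[OF p that e(1)] ideal.I_r_closed[OF p_ideal _ e(1), of r] e(2) by blast
  moreover have "annihilator R M (e \<odot>\<^bsub>M\<^esub> x) \<subseteq> carrier R" by (auto simp: annihilator_def)
  ultimately show ?thesis using ideal.Icarr[OF p_ideal] by blast
qed

theorem fair_principal_idempotent:
  assumes prin: "principalideal \<aa> R" and idem: "\<aa> \<cdot>\<^bsub>R\<^esub> \<aa> = \<aa>"
  shows "fair R \<aa> M"
proof -
  note id = principalideal.axioms(1)[OF prin]
  obtain e where e: "e \<in> carrier R" and ee: "e \<otimes>\<^bsub>R\<^esub> e = e" and gen: "\<aa> = PIdl\<^bsub>R\<^esub> e"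
    using R.principal_idempotent_ideal_generator[OF prin idem] .
  let ?N = "torsion R \<aa> M"
  note ann = annihilator_quotient_idempotent_torsion[OF id idem e gen]
  have carr: "carrier (quotient_module M ?N) = (\<lambda>x. ?N +>\<^bsub>M\<^esub> x) ` carrier M"
    by (auto simp: quotient_module_def A_RCOSETS_def')
  have e\<aa>: "e \<in> \<aa>" using R.cgenideal_self[OF e] gen by simp
  have sub: "\<aa> \<subseteq> \<pp>" if "primeideal \<pp> R" "e \<in> \<pp>" for \<pp>
    using R.cgenideal_minimal[OF primeideal.axioms(1)[OF that(1)] that(2)] gen by simp
  have "\<pp> \<in> Ass R (quotient_module M ?N) \<longleftrightarrow> \<pp> \<in> Ass R M - Var R \<aa>" for \<pp>
  proof
    assume "\<pp> \<in> Ass R (quotient_module M ?N)"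
    then obtain x where p: "primeideal \<pp> R" and x: "x \<in> carrier M"
      and eq: "\<pp> = annihilator R M (e \<odot>\<^bsub>M\<^esub> x)"
      unfolding Ass_def using carr ann by auto
    have "e \<notin> \<pp>"
    proof
      assume "e \<in> \<pp>"
      then have "e \<odot>\<^bsub>M\<^esub> x = \<zero>\<^bsub>M\<^esub>"
        using e x ee by (simp add: eq annihilator_def smult_assoc1[symmetric])
      then have "\<pp> = carrier R" by (auto simp: eq annihilator_def)
      then show False using primeideal.I_notcarr[OF p] by simp
    qed
    then show "\<pp> \<in> Ass R M - Var R \<aa>"
      using p x e eq e\<aa> unfolding Ass_def Var_def by auto
  next
    assume "\<pp> \<in> Ass R M - Var R \<aa>"
    then obtain x where p: "primeideal \<pp> R" and x: "x \<in> carrier M"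
      and eq: "\<pp> = annihilator R M x" and "\<not> \<aa> \<subseteq> \<pp>"
      unfolding Ass_def Var_def by blast
    then have "e \<notin> \<pp>" using sub by blast
    then have "\<pp> = annihilator R (quotient_module M ?N) (?N +>\<^bsub>M\<^esub> x)"
      using ann[OF x] prime_annihilator_smult[OF p eq x e] by simp
    then show "\<pp> \<in> Ass R (quotient_module M ?N)"
      unfolding Ass_def using p x carr by blast
  qed
  then show ?thesis unfolding fair_def by blast
qed

end

theorem mainTheorem7:
  fixes R (structure) and \<aa>
  assumes "cring R"
    and "ideal \<aa> R"
    and "principalideal \<aa> R"
    and "\<aa> \<cdot> \<aa> = \<aa>"
  shows "fair R \<aa> (regular_module R)"
  using module.fair_principal_idempotent[OF regular_module_is_module[OF assms(1)] assms(3,4)] .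

end
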